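(* Let $M$ be a matroid with set of circuits $\mathcal{C}(M)$ and set of cocircuits $\mathcal{C}^*(M)$. Introduce variables $a_{e,X}$ for each pair $X\in\mathcal{C}(M)$, $e\in X$, and $b_{e,Y}$ for each pair $Y\in\mathcal{C}^*(M)$, $e\in Y$, and let $R$ be the polynomial ring over $F_2$ in these variables. Consider the system of polynomial equations in $R$ consisting of: for every $X\in\mathcal{C}(M)$, $Y\in\mathcal{C}^*(M)$ with $X\cap Y=\{e,f\}$ (two distinct elements), $$a_{e,X}+b_{e,Y}+a_{f,X}+b_{f,Y}+1=0,$$ and for every $X\in\mathcal{C}(M)$, $Y\in\mathcal{C}^*(M)$ with $X\cap Y=\{e,f,g\}$ (three distinct elements), $$1+a_{e,X}+b_{e,Y}+a_{f,X}+b_{f,Y}+a_{g,X}+b_{g,Y}+a_{e,X}a_{f,X}+a_{e,X}a_{g,X}+a_{e,X}b_{f,Y}+a_{e,X}b_{g,Y}+a_{f,X}a_{g,X}$$ $$+a_{f,X}b_{e,Y}+a_{f,X}b_{g,Y}+a_{g,X}b_{e,Y}+a_{g,X}b_{f,Y}+b_{e,Y}b_{f,Y}+b_{e,Y}b_{g,Y}+b_{f,Y}b_{g,Y}=0.$$ Then $M$ is orientable if and only if this system has a solution over $F_2$.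
   Context: With $\Sigma=\{0,+,-\}$ (multiplied and compared with $0$ as signs), a $\Sigma$-mapping for a matroid $M$ is a pair of maps $\phi_\Sigma:E(M)\times\mathcal{C}(M)\to\Sigma$, $\phi^*_\Sigma:E(M)\times\mathcal{C}^*(M)\to\Sigma$ with $\phi_\Sigma(e,X)=0$ iff $e\notin X$ and $\phi^*_\Sigma(e,Y)=0$ iff $e\notin Y$. The matroid $M$ is orientable if it has a $\Sigma$-mapping such that for every $X\in\mathcal{C}(M)$, $Y\in\mathcal{C}^*(M)$ with $|X\cap Y|\in\{2,3\}$: $\phi_\Sigma(e,X)\phi^*_\Sigma(e,Y)>0$ for some $e\in X\cap Y$ if and only if $\phi_\Sigma(f,X)\phi^*_\Sigma(f,Y)<0$ for some $f\in X\cap Y$. *)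

theory Defs
  imports "HOL-Library.FuncSet" "HOL-Library.Poly_Mapping" "HOL-Library.Z2"
begin

locale matroid =
  fixes E :: "'a set" and indep :: "'a set \<Rightarrow> bool"
  assumes finite_ground: "finite E"
    and indep_subset_ground: "indep X \<Longrightarrow> X \<subseteq> E"
    and indep_empty: "indep {}"
    and indep_subset: "indep X \<Longrightarrow> Y \<subseteq> X \<Longrightarrow> indep Y"
    and indep_augment:
      "indep X \<Longrightarrow> indep Y \<Longrightarrow> card X < card Y \<Longrightarrow> \<exists>y \<in> Y - X. indep (insert y X)"

definition basis :: "'a set \<Rightarrow> ('a set \<Rightarrow> bool) \<Rightarrow> 'a set \<Rightarrow> bool" where
  "basis E indep B \<longleftrightarrow> B \<subseteq> E \<and> indep B \<and> (\<forall>X. B \<subset> X \<and> X \<subseteq> E \<longrightarrow> \<not> indep X)"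

definition circuits :: "'a set \<Rightarrow> ('a set \<Rightarrow> bool) \<Rightarrow> 'a set set" where
  "circuits E indep = {X. X \<subseteq> E \<and> \<not> indep X \<and> (\<forall>Y. Y \<subset> X \<longrightarrow> indep Y)}"

text \<open>The bases of the dual matroid are the complements of the bases.\<close>

definition dual_indep :: "'a set \<Rightarrow> ('a set \<Rightarrow> bool) \<Rightarrow> 'a set \<Rightarrow> bool" where
  "dual_indep E indep X \<longleftrightarrow> (\<exists>B. basis E indep B \<and> X \<subseteq> E - B)"

definition cocircuits :: "'a set \<Rightarrow> ('a set \<Rightarrow> bool) \<Rightarrow> 'a set set" where
  "cocircuits E indep = circuits E (dual_indep E indep)"

text \<open>The signs \<open>0, +, -\<close> are the integers \<open>0, 1, -1\<close>, with their product and order.\<close>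

definition signs :: "int set" where
  "signs = {0, 1, -1}"

definition sign_mapping ::
  "'a set \<Rightarrow> ('a set \<Rightarrow> bool) \<Rightarrow> ('a \<Rightarrow> 'a set \<Rightarrow> int) \<Rightarrow> ('a \<Rightarrow> 'a set \<Rightarrow> int) \<Rightarrow> bool" where
  "sign_mapping E indep \<phi> \<psi> \<longleftrightarrow>
    (\<forall>e \<in> E. \<forall>X \<in> circuits E indep. \<phi> e X \<in> signs \<and> (\<phi> e X = 0 \<longleftrightarrow> e \<notin> X)) \<and>
    (\<forall>e \<in> E. \<forall>Y \<in> cocircuits E indep. \<psi> e Y \<in> signs \<and> (\<psi> e Y = 0 \<longleftrightarrow> e \<notin> Y))"

definition orientable :: "'a set \<Rightarrow> ('a set \<Rightarrow> bool) \<Rightarrow> bool" where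
  "orientable E indep \<longleftrightarrow>
    (\<exists>\<phi> \<psi>. sign_mapping E indep \<phi> \<psi> \<and>
      (\<forall>X \<in> circuits E indep. \<forall>Y \<in> cocircuits E indep. card (X \<inter> Y) \<in> {2, 3} \<longrightarrow>
        ((\<exists>e \<in> X \<inter> Y. \<phi> e X * \<psi> e Y > 0) \<longleftrightarrow> (\<exists>f \<in> X \<inter> Y. \<phi> f X * \<psi> f Y < 0))))"

text \<open>
  Polynomials with coefficients in \<open>'c\<close> and variables in \<open>'v\<close>: a monomial is its finitely
  supported exponent function, a polynomial its finitely supported coefficient function; the
  ring structure on \<open>\<Rightarrow>\<^sub>0\<close> is convolution.
\<close>

type_synonym ('v, 'c) mpoly = "('v \<Rightarrow>\<^sub>0 nat) \<Rightarrow>\<^sub>0 'c"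

definition Var :: "'v \<Rightarrow> ('v, 'c::comm_ring_1) mpoly" where
  "Var x = Poly_Mapping.single (Poly_Mapping.single x 1) 1"

definition poly_vars :: "('v, 'c::zero) mpoly \<Rightarrow> 'v set" where
  "poly_vars p = (\<Union>m \<in> Poly_Mapping.keys p. Poly_Mapping.keys m)"

definition poly_ring :: "'v set \<Rightarrow> ('v, 'c::zero) mpoly set" where
  "poly_ring V = {p. poly_vars p \<subseteq> V}"

definition eval_mpoly :: "('v \<Rightarrow> 'c) \<Rightarrow> ('v, 'c::comm_ring_1) mpoly \<Rightarrow> 'c" where
  "eval_mpoly v p =
    (\<Sum>m \<in> Poly_Mapping.keys p. Poly_Mapping.lookup p m *
      (\<Prod>x \<in> Poly_Mapping.keys m. v x ^ Poly_Mapping.lookup m x))"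

text \<open>The points of affine space with coordinates \<open>V\<close> are the functions defined exactly on \<open>V\<close>.\<close>

definition has_solution :: "'v set \<Rightarrow> ('v, 'c::comm_ring_1) mpoly set \<Rightarrow> bool" where
  "has_solution V S \<longleftrightarrow> (\<exists>v \<in> V \<rightarrow>\<^sub>E UNIV. \<forall>p \<in> S. eval_mpoly v p = 0)"

text \<open>\<open>VarA e X\<close> and \<open>VarB e Y\<close> are the indices of the variables $a_{e,X}$ and $b_{e,Y}$.\<close>

datatype 'a var = VarA 'a "'a set" | VarB 'a "'a set"

definition orientation_vars :: "'a set \<Rightarrow> ('a set \<Rightarrow> bool) \<Rightarrow> 'a var set" where
  "orientation_vars E indep =
    {VarA e X | e X. X \<in> circuits E indep \<and> e \<in> X} \<union>
    {VarB e Y | e Y. Y \<in> cocircuits E indep \<and> e \<in> Y}"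

definition two_poly :: "'a set \<Rightarrow> 'a set \<Rightarrow> 'a \<Rightarrow> 'a \<Rightarrow> ('a var, bit) mpoly" where
  "two_poly X Y e f =
    (let a = (\<lambda>x. Var (VarA x X)); b = (\<lambda>x. Var (VarB x Y))
     in a e + b e + a f + b f + 1)"

definition three_poly :: "'a set \<Rightarrow> 'a set \<Rightarrow> 'a \<Rightarrow> 'a \<Rightarrow> 'a \<Rightarrow> ('a var, bit) mpoly" where
  "three_poly X Y e f g =
    (let a = (\<lambda>x. Var (VarA x X)); b = (\<lambda>x. Var (VarB x Y))
     in 1 + a e + b e + a f + b f + a g + b g
        + a e * a f + a e * a g + a e * b f + a e * b g + a f * a g
        + a f * b e + a f * b g + a g * b e + a g * b f
        + b e * b f + b e * b g + b f * b g)"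

definition orientation_system :: "'a set \<Rightarrow> ('a set \<Rightarrow> bool) \<Rightarrow> ('a var, bit) mpoly set" where
  "orientation_system E indep =
    {two_poly X Y e f | X Y e f.
      X \<in> circuits E indep \<and> Y \<in> cocircuits E indep \<and> e \<noteq> f \<and> X \<inter> Y = {e, f}} \<union>
    {three_poly X Y e f g | X Y e f g.
      X \<in> circuits E indep \<and> Y \<in> cocircuits E indep \<and> e \<noteq> f \<and> e \<noteq> g \<and> f \<noteq> g \<and>
      X \<inter> Y = {e, f, g}}"

lemma poly_ring_1: "(1 :: ('v, 'c::comm_ring_1) mpoly) \<in> poly_ring V"
  by (simp add: poly_ring_def poly_vars_def)

lemma poly_ring_Var: "x \<in> V \<Longrightarrow> (Var x :: ('v, 'c::comm_ring_1) mpoly) \<in> poly_ring V"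
  by (simp add: poly_ring_def poly_vars_def Var_def)

lemma poly_ring_add:
  fixes p q :: "('v, 'c::comm_ring_1) mpoly"
  shows "p \<in> poly_ring V \<Longrightarrow> q \<in> poly_ring V \<Longrightarrow> p + q \<in> poly_ring V"
  unfolding poly_ring_def poly_vars_def using keys_add[of p q] by blast

lemma poly_ring_mult:
  fixes p q :: "('v, 'c::comm_ring_1) mpoly"
  assumes "p \<in> poly_ring V" "q \<in> poly_ring V"
  shows "p * q \<in> poly_ring V"
proof -
  have "x \<in> V" if m: "m \<in> Poly_Mapping.keys (p * q)" and x: "x \<in> Poly_Mapping.keys m" for m x
  proof -
    obtain s t where "m = s + t" "s \<in> Poly_Mapping.keys p" "t \<in> Poly_Mapping.keys q"
      using m keys_mult[of p q] by blast
    then show ?thesis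
      using x assms keys_add[of s t] unfolding poly_ring_def poly_vars_def by blast
  qed
  then show ?thesis
    unfolding poly_ring_def poly_vars_def by blast
qed

lemma orientation_system_subset:
  "orientation_system E indep \<subseteq> poly_ring (orientation_vars E indep)"
proof -
  have a: "Var (VarA x X) \<in> poly_ring (orientation_vars E indep)"
    if "X \<in> circuits E indep" "x \<in> X" for x X
    using that by (intro poly_ring_Var) (auto simp: orientation_vars_def)
  have b: "Var (VarB x Y) \<in> poly_ring (orientation_vars E indep)"
    if "Y \<in> cocircuits E indep" "x \<in> Y" for x Y
    using that by (intro poly_ring_Var) (auto simp: orientation_vars_def)
  show ?thesis
    unfolding orientation_system_def two_poly_def three_poly_def Let_def
    apply clarify
    apply (elim UnE CollectE exE conjE; hypsubst)
     apply (intro poly_ring_add poly_ring_mult poly_ring_1 a b; blast)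
    apply (intro poly_ring_add poly_ring_mult poly_ring_1 a b; blast)
    done
qed

lemma eval_mpoly_1: "eval_mpoly v (1 :: ('v, 'c::comm_ring_1) mpoly) = 1"
  by (simp add: eval_mpoly_def)

lemma eval_mpoly_Var: "eval_mpoly v (Var x :: ('v, 'c::comm_ring_1) mpoly) = v x"
  by (simp add: eval_mpoly_def Var_def)

lemma eval_mpoly_add:
  fixes p q :: "('v, 'c::comm_ring_1) mpoly"
  shows "eval_mpoly v (p + q) = eval_mpoly v p + eval_mpoly v q"
  unfolding eval_mpoly_def
  by (rule setsum_keys_plus_distrib) (simp_all add: distrib_right)

lemma eval_mpoly_Var_mult:
  "eval_mpoly v (Var x * Var y :: ('v, 'c::comm_ring_1) mpoly) = v x * v y"
proof (cases "x = y")
  case True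
  then show ?thesis
    by (simp add: eval_mpoly_def Var_def mult_single single_add[symmetric] power2_eq_square)
next
  case False
  let ?m = "Poly_Mapping.single x 1 + Poly_Mapping.single y (1::nat)"
  have "Poly_Mapping.keys ?m = {x, y}"
    using False by (auto simp: in_keys_iff lookup_add lookup_single when_def split: if_splits)
  then show ?thesis
    using False by (simp add: eval_mpoly_def Var_def mult_single lookup_add lookup_single when_def)
qed

end

theory Submission
  imports Defs
begin

text \<open>
  Encode the sign \<open>+\<close> as \<open>0\<close> and the sign \<open>-\<close> as \<open>1\<close> in \<open>F\<^sub>2\<close>, so that products of signs become sums.
  With $s_x = a_{x,X} + b_{x,Y}$, the equation for $X \cap Y = \{e,f\}$ says $s_e + s_f = 1$, and the
  one for $X \cap Y = \{e,f,g\}$ says $1 + k + {k \choose 2} = 0$ in \<open>F\<^sub>2\<close>, where $k$ is the number of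
  ones among $s_e, s_f, s_g$. Either holds exactly when both signs occur on $X \cap Y$.
\<close>

definition bit_sign :: "bit \<Rightarrow> int" where
  "bit_sign b = (if b = 0 then 1 else -1)"

lemma bit_sign_mult: "bit_sign a * bit_sign b = bit_sign (a + b)"
  by (cases a; cases b) (simp_all add: bit_sign_def)

lemma bit_sign_pos_iff: "bit_sign b > 0 \<longleftrightarrow> b = 0"
  and bit_sign_neg_iff: "bit_sign b < 0 \<longleftrightarrow> b = 1"
  by (cases b; simp add: bit_sign_def)+

lemma bit_sign_in_signs: "bit_sign b \<in> signs"
  and bit_sign_nonzero: "bit_sign b \<noteq> 0"
  by (simp_all add: bit_sign_def signs_def)

text \<open>Inverts \<open>bit_sign\<close> on the nonzero signs, so that a bit can be read off from
  any sign of a given orientation.\<close>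

lemma nonzero_sign_eq_bit_sign:
  "s \<in> signs \<Longrightarrow> s \<noteq> 0 \<Longrightarrow> s = bit_sign (if s < 0 then 1 else 0)"
  by (auto simp: signs_def bit_sign_def)

text \<open>Every bit is 0 or 1, so the two sides of the inner equivalence cannot both fail; it
  therefore says that both values occur. The proof checks all 16 assignments.\<close>

lemma eval_two_poly_eq_0_iff:
  "eval_mpoly v (two_poly X Y e f) = 0 \<longleftrightarrow>
    ((\<exists>x \<in> {e, f}. v (VarA x X) + v (VarB x Y) = 0) \<longleftrightarrow>
     (\<exists>x \<in> {e, f}. v (VarA x X) + v (VarB x Y) = 1))"
  unfolding two_poly_def Let_def eval_mpoly_add eval_mpoly_1 eval_mpoly_Var
  by (cases "v (VarA e X)"; cases "v (VarB e Y)"; cases "v (VarA f X)"; cases "v (VarB f Y)") simp_all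

lemma eval_three_poly_eq_0_iff:
  "eval_mpoly v (three_poly X Y e f g) = 0 \<longleftrightarrow>
    ((\<exists>x \<in> {e, f, g}. v (VarA x X) + v (VarB x Y) = 0) \<longleftrightarrow>
     (\<exists>x \<in> {e, f, g}. v (VarA x X) + v (VarB x Y) = 1))"
  unfolding three_poly_def Let_def eval_mpoly_add eval_mpoly_1 eval_mpoly_Var eval_mpoly_Var_mult
  by (cases "v (VarA e X)"; cases "v (VarB e Y)"; cases "v (VarA f X)"; cases "v (VarB f Y)";
      cases "v (VarA g X)"; cases "v (VarB g Y)") simp_all

text \<open>The polynomials are indexed by enumerations of \<open>X \<inter> Y\<close>, but their
  vanishing depends only on the set, so any one enumeration suffices to recover the
  condition.\<close>

lemma orientation_system_vanishes_iff:
  "(\<forall>p \<in> orientation_system E indep. eval_mpoly v p = 0) \<longleftrightarrow>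
    (\<forall>X \<in> circuits E indep. \<forall>Y \<in> cocircuits E indep. card (X \<inter> Y) \<in> {2, 3} \<longrightarrow>
      ((\<exists>x \<in> X \<inter> Y. v (VarA x X) + v (VarB x Y) = 0) \<longleftrightarrow>
       (\<exists>x \<in> X \<inter> Y. v (VarA x X) + v (VarB x Y) = 1)))"
  (is "?L \<longleftrightarrow> ?R")
proof -
  \<comment> \<open>The set \<open>S\<close> is a parameter so that the condition can be moved
    between \<open>X \<inter> Y\<close> and an explicit enumeration of it.\<close>
  let ?balanced = "\<lambda>X Y S. (\<exists>x \<in> S. v (VarA x X) + v (VarB x Y) = 0) \<longleftrightarrow>
    (\<exists>x \<in> S. v (VarA x X) + v (VarB x Y) = 1)"
  have forward: "?balanced X Y (X \<inter> Y)"
    if L: ?L and X: "X \<in> circuits E indep" and Y: "Y \<in> cocircuits E indep"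
      and card: "card (X \<inter> Y) \<in> {2, 3}" for X Y
  proof -
    from card consider "card (X \<inter> Y) = 2" | "card (X \<inter> Y) = 3"
      by blast
    then show "?balanced X Y (X \<inter> Y)"
    proof cases
      case 1
      then obtain e f where ef: "X \<inter> Y = {e, f}" "e \<noteq> f"
        by (auto simp: card_2_iff)
      then have "two_poly X Y e f \<in> orientation_system E indep"
        using X Y unfolding orientation_system_def by blast
      with L have "eval_mpoly v (two_poly X Y e f) = 0"
        by blast
      then show ?thesis
        unfolding ef(1) eval_two_poly_eq_0_iff .
    next
      case 2
      then obtain e f g where efg: "X \<inter> Y = {e, f, g}" "e \<noteq> f" "e \<noteq> g" "f \<noteq> g"
        by (auto simp: card_3_iff)
      then have "three_poly X Y e f g \<in> orientation_system E indep"
        using X Y unfolding orientation_system_def by blast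
      with L have "eval_mpoly v (three_poly X Y e f g) = 0"
        by blast
      then show ?thesis
        unfolding efg(1) eval_three_poly_eq_0_iff .
    qed
  qed
  have backward: "eval_mpoly v p = 0" if R: ?R and p: "p \<in> orientation_system E indep" for p
  proof -
    from p consider
      (two) X Y e f where "p = two_poly X Y e f" "X \<in> circuits E indep" "Y \<in> cocircuits E indep"
        "e \<noteq> f" "X \<inter> Y = {e, f}"
    | (three) X Y e f g where "p = three_poly X Y e f g" "X \<in> circuits E indep"
        "Y \<in> cocircuits E indep" "e \<noteq> f" "e \<noteq> g" "f \<noteq> g" "X \<inter> Y = {e, f, g}"
      unfolding orientation_system_def by blast
    then show "eval_mpoly v p = 0"
    proof cases
      case two
      then have card: "card (X \<inter> Y) \<in> {2, 3}"
        by simp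
      have "?balanced X Y {e, f}"
        using R[rule_format, OF two(2,3) card] unfolding two(5) .
      with two show ?thesis
        by (simp only: eval_two_poly_eq_0_iff)
    next
      case three
      then have card: "card (X \<inter> Y) \<in> {2, 3}"
        by simp
      have "?balanced X Y {e, f, g}"
        using R[rule_format, OF three(2,3) card] unfolding three(7) .
      with three show ?thesis
        by (simp only: eval_three_poly_eq_0_iff)
    qed
  qed
  show ?thesis
  proof
    show ?R if ?L
      by (rule ballI, rule ballI, rule impI, rule forward[OF that])
    show ?L if ?R
      by (rule ballI, rule backward[OF that])
  qed
qed

text \<open>The signs and the bits need to agree only on members of circuits and cocircuits, so this
  serves both directions of the theorem.\<close>

lemma orientation_system_vanishes_iff_signs:
  assumes \<phi>: "\<And>e X. X \<in> circuits E indep \<Longrightarrow> e \<in> X \<Longrightarrow> \<phi> e X = bit_sign (v (VarA e X))"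
    and \<psi>: "\<And>e Y. Y \<in> cocircuits E indep \<Longrightarrow> e \<in> Y \<Longrightarrow> \<psi> e Y = bit_sign (v (VarB e Y))"
  shows "(\<forall>p \<in> orientation_system E indep. eval_mpoly v p = 0) \<longleftrightarrow>
    (\<forall>X \<in> circuits E indep. \<forall>Y \<in> cocircuits E indep. card (X \<inter> Y) \<in> {2, 3} \<longrightarrow>
      ((\<exists>e \<in> X \<inter> Y. \<phi> e X * \<psi> e Y > 0) \<longleftrightarrow> (\<exists>f \<in> X \<inter> Y. \<phi> f X * \<psi> f Y < 0)))"
proof -
  have "\<phi> e X * \<psi> e Y = bit_sign (v (VarA e X) + v (VarB e Y))"
    if "X \<in> circuits E indep" "Y \<in> cocircuits E indep" "e \<in> X \<inter> Y" for e X Y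
    using that by (simp add: \<phi> \<psi> bit_sign_mult)
  then show ?thesis
    unfolding orientation_system_vanishes_iff
    \<comment> \<open>The product formula is conditional on membership; the congruence rules supply
      these conditions under the bounded quantifiers.\<close>
    by (simp only: bit_sign_pos_iff bit_sign_neg_iff cong: ball_cong bex_cong)
qed

theorem theorem3p2:
  fixes E :: "'a set" and indep :: "'a set \<Rightarrow> bool"
  assumes "matroid E indep"
  shows "orientable E indep \<longleftrightarrow>
    has_solution (orientation_vars E indep) (orientation_system E indep)"
proof
  assume "orientable E indep"
  then obtain \<phi> \<psi> where sm: "sign_mapping E indep \<phi> \<psi>"
    and bal: "\<forall>X \<in> circuits E indep. \<forall>Y \<in> cocircuits E indep. card (X \<inter> Y) \<in> {2, 3} \<longrightarrow>
      ((\<exists>e \<in> X \<inter> Y. \<phi> e X * \<psi> e Y > 0) \<longleftrightarrow> (\<exists>f \<in> X \<inter> Y. \<phi> f X * \<psi> f Y < 0))"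
    unfolding orientable_def by blast
  \<comment> \<open>Negative signs become 1, positive ones 0. The restriction makes \<open>v\<close>
    a point with exactly the required coordinates.\<close>
  define v :: "'a var \<Rightarrow> bit" where
    "v = restrict (\<lambda>x. case x of VarA e X \<Rightarrow> if \<phi> e X < 0 then 1 else 0
                               | VarB e Y \<Rightarrow> if \<psi> e Y < 0 then 1 else 0)
                  (orientation_vars E indep)"
  have \<phi>: "\<phi> e X = bit_sign (v (VarA e X))" if "X \<in> circuits E indep" "e \<in> X" for e X
  proof -
    have "v (VarA e X) = (if \<phi> e X < 0 then 1 else 0)"
      using that by (auto simp: v_def orientation_vars_def)
    \<comment> \<open>\<open>sign_mapping\<close> constrains signs only at elements of
      \<open>E\<close>, which contains every circuit.\<close>
    moreover have "e \<in> E"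
      using that by (auto simp: circuits_def)
    then have "\<phi> e X \<in> signs" "\<phi> e X \<noteq> 0"
      using sm that unfolding sign_mapping_def by blast+
    ultimately show ?thesis
      by (metis nonzero_sign_eq_bit_sign)
  qed
  have \<psi>: "\<psi> e Y = bit_sign (v (VarB e Y))" if "Y \<in> cocircuits E indep" "e \<in> Y" for e Y
  proof -
    have "v (VarB e Y) = (if \<psi> e Y < 0 then 1 else 0)"
      using that by (auto simp: v_def orientation_vars_def)
    moreover have "e \<in> E"
      using that by (auto simp: cocircuits_def circuits_def)
    then have "\<psi> e Y \<in> signs" "\<psi> e Y \<noteq> 0"
      using sm that unfolding sign_mapping_def by blast+
    ultimately show ?thesis
      by (metis nonzero_sign_eq_bit_sign)
  qed
  have "v \<in> orientation_vars E indep \<rightarrow>\<^sub>E UNIV"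
    by (simp add: v_def)
  moreover have "\<forall>p \<in> orientation_system E indep. eval_mpoly v p = 0"
    using orientation_system_vanishes_iff_signs[of E indep \<phi> v \<psi>, OF \<phi> \<psi>] bal by blast
  ultimately show "has_solution (orientation_vars E indep) (orientation_system E indep)"
    unfolding has_solution_def by blast
next
  assume "has_solution (orientation_vars E indep) (orientation_system E indep)"
  then obtain v where v: "\<forall>p \<in> orientation_system E indep. eval_mpoly v p = 0"
    unfolding has_solution_def by blast
  \<comment> \<open>The value 0 off the circuit or cocircuit is forced by
    \<open>sign_mapping\<close>; on it the bit decides the sign.\<close>
  define \<phi> where "\<phi> e X = (if e \<in> X then bit_sign (v (VarA e X)) else 0)" for e X
  define \<psi> where "\<psi> e Y = (if e \<in> Y then bit_sign (v (VarB e Y)) else 0)" for e Y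
  have "sign_mapping E indep \<phi> \<psi>"
    using bit_sign_in_signs bit_sign_nonzero
    by (auto simp: sign_mapping_def \<phi>_def \<psi>_def signs_def)
  moreover have "\<forall>X \<in> circuits E indep. \<forall>Y \<in> cocircuits E indep. card (X \<inter> Y) \<in> {2, 3} \<longrightarrow>
      ((\<exists>e \<in> X \<inter> Y. \<phi> e X * \<psi> e Y > 0) \<longleftrightarrow> (\<exists>f \<in> X \<inter> Y. \<phi> f X * \<psi> f Y < 0))"
    \<comment> \<open>The sign condition does not mention \<open>v\<close>, so matching alone cannot
      determine it.\<close>
    using v by (subst orientation_system_vanishes_iff_signs[symmetric, where v = v])
      (simp_all add: \<phi>_def \<psi>_def)
  ultimately show "orientable E indep"
    unfolding orientable_def by blast
qed

end
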